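(* Let $l^2_2$ be the $\mathbb{M}(2)$-module of all sequences $\{w_l\}_{l\ge1}$ of bicomplex numbers with $\sum_{l=1}^\infty|w_l|^2<\infty$, equipped with the bicomplex scalar product $$(\{w_l\},\{w_l'\})=\mathbf{e_1}\sum_{l=1}^\infty\overline{P_1(w_l)}\,P_1(w_l')+\mathbf{e_2}\sum_{l=1}^\infty\overline{P_2(w_l)}\,P_2(w_l')$$ and with the norm $\|\{w_l\}\|_2=\big(\sum_{l=1}^\infty|w_l|^2\big)^{1/2}$ as its induced norm. Then $l^2_2$ is a bicomplex Hilbert space.
   Context: Bicomplex numbers: $\mathbb{M}(2)=\{z_1+z_2\mathbf{i_2} : z_1,z_2\in\mathbb{C}(\mathbf{i_1})\}$, where $\mathbf{i_1},\mathbf{i_2}$ are independent commuting imaginary units with $\mathbf{i_1}^2=\mathbf{i_2}^2=-1$, and $\mathbb{C}(\mathbf{i_1})=\{x+y\mathbf{i_1}: x,y\in\mathbb{R}\}\cong\mathbb{C}$. Put $\mathbf{j}=\mathbf{i_1}\mathbf{i_2}$ (so $\mathbf{j}^2=1$). $\mathbb{M}(2)$ is a commutative ring. For $w=z_1+z_2\mathbf{i_2}$: the conjugate is $w^{\dagger_3}=\bar z_1-\bar z_2\mathbf{i_2}$ (bar is conjugation in $\mathbb{C}(\mathbf{i_1})$), and the Euclidean norm is $|w|=\sqrt{|z_1|^2+|z_2|^2}$. Put $\mathbf{e_1}=(1+\mathbf{j})/2$, $\mathbf{e_2}=(1-\mathbf{j})/2$; these are idempotents with $\mathbf{e_1}+\mathbf{e_2}=1$,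 $\mathbf{e_1}\mathbf{e_2}=0$. Every $w$ is uniquely $w=P_1(w)\mathbf{e_1}+P_2(w)\mathbf{e_2}$ with $P_1(w)=z_1-z_2\mathbf{i_1}$, $P_2(w)=z_1+z_2\mathbf{i_1}$ in $\mathbb{C}(\mathbf{i_1})$. Let $\mathbb{D}_+=\{x\mathbf{e_1}+y\mathbf{e_2}: x,y\ge 0 \text{ real}\}$. Scalar product: for an $\mathbb{M}(2)$-module $M$ (elements are written $|\psi\rangle$), a bicomplex scalar product is a map $(\cdot,\cdot):M\times M\to\mathbb{M}(2)$ that is additive and $\mathbb{M}(2)$-homogeneous in the second argument, satisfies $(|\psi\rangle,|\phi\rangle)=(|\phi\rangle,|\psi\rangle)^{\dagger_3}$, satisfies $(|\psi\rangle,|\psi\rangle)=0\Leftrightarrow|\psi\rangle=0$, and is hyperbolic positive: $(|\psi\rangle,|\psi\rangle)\in\mathbb{D}_+$ for all $|\psi\rangle$. The induced norm is $\|\,|\phi\rangle\|=\frac{1}{\sqrt2}\sqrt{P_1((|\phi\rangle,|\phi\rangle))+P_2((|\phi\rangle,|\phi\rangle))}$. A bicomplex Hilbert space is an $\mathbb{M}(2)$-module with a bicomplex scalar product that is complete for the induced norm. Standing convention: bicomplex Hilbert spaces are infinite dimensional, meaning that for every $n$ they contain $n$ elements that are linearly independent over $\mathbb{M}(2)$. Module operations on $l^2_2$ are componentwise. *)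

theory Defs
  imports "HOL-Analysis.Analysis"
begin

section \<open>Bicomplex numbers\<close>

text \<open>\<open>Bicomplex z1 z2\<close> stands for \<open>z1 + z2 i2\<close>; the field generated by \<open>i1\<close> is the type
  \<^typ>\<open>complex\<close>, with \<open>i1\<close> being \<^term>\<open>\<i>\<close>.\<close>

datatype bicomplex = Bicomplex (bc_fst: complex) (bc_snd: complex)

instantiation bicomplex :: comm_ring_1
begin

definition zero_bicomplex :: bicomplex where "0 = Bicomplex 0 0"
definition one_bicomplex :: bicomplex where "1 = Bicomplex 1 0"
definition plus_bicomplex :: "bicomplex \<Rightarrow> bicomplex \<Rightarrow> bicomplex" where
  "v + w = Bicomplex (bc_fst v + bc_fst w) (bc_snd v + bc_snd w)"
definition uminus_bicomplex :: "bicomplex \<Rightarrow> bicomplex" where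
  "- w = Bicomplex (- bc_fst w) (- bc_snd w)"
definition minus_bicomplex :: "bicomplex \<Rightarrow> bicomplex \<Rightarrow> bicomplex" where
  "v - w = Bicomplex (bc_fst v - bc_fst w) (bc_snd v - bc_snd w)"
definition times_bicomplex :: "bicomplex \<Rightarrow> bicomplex \<Rightarrow> bicomplex" where
  "v * w = Bicomplex (bc_fst v * bc_fst w - bc_snd v * bc_snd w)
                     (bc_fst v * bc_snd w + bc_snd v * bc_fst w)"

instance
  by standard
    (simp_all add: zero_bicomplex_def one_bicomplex_def plus_bicomplex_def uminus_bicomplex_def
      minus_bicomplex_def times_bicomplex_def algebra_simps)

end

definition bc_of_complex :: "complex \<Rightarrow> bicomplex" where
  "bc_of_complex z = Bicomplex z 0"

definition bc_i1 :: bicomplex where "bc_i1 = bc_of_complex \<i>"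
definition bc_i2 :: bicomplex where "bc_i2 = Bicomplex 0 1"
definition bc_j :: bicomplex where "bc_j = bc_i1 * bc_i2"
definition bc_e1 :: bicomplex where "bc_e1 = bc_of_complex (1/2) * (1 + bc_j)"
definition bc_e2 :: bicomplex where "bc_e2 = bc_of_complex (1/2) * (1 - bc_j)"

definition bc_P1 :: "bicomplex \<Rightarrow> complex" where "bc_P1 w = bc_fst w - bc_snd w * \<i>"
definition bc_P2 :: "bicomplex \<Rightarrow> complex" where "bc_P2 w = bc_fst w + bc_snd w * \<i>"

definition bc_dagger3 :: "bicomplex \<Rightarrow> bicomplex" where
  "bc_dagger3 w = bc_of_complex (cnj (bc_fst w)) - bc_of_complex (cnj (bc_snd w)) * bc_i2"

text \<open>This is not made an instance of \<^class>\<open>real_normed_algebra\<close>: the Euclidean norm is not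
  submultiplicative on the bicomplex numbers.\<close>

definition bc_norm :: "bicomplex \<Rightarrow> real" where
  "bc_norm w = sqrt ((cmod (bc_fst w))\<^sup>2 + (cmod (bc_snd w))\<^sup>2)"

definition bc_Dplus :: "bicomplex set" where
  "bc_Dplus = {bc_of_complex (complex_of_real x) * bc_e1 + bc_of_complex (complex_of_real y) * bc_e2
               | x y. 0 \<le> x \<and> 0 \<le> y}"

lemma bicomplex_form: "w = bc_of_complex (bc_fst w) + bc_of_complex (bc_snd w) * bc_i2"
  by (cases w) (simp add: bc_of_complex_def bc_i2_def plus_bicomplex_def times_bicomplex_def)

lemma bc_units:
  "bc_i1 * bc_i1 = -1" "bc_i2 * bc_i2 = -1" "bc_j * bc_j = 1"
  "bc_e1 * bc_e1 = bc_e1" "bc_e2 * bc_e2 = bc_e2" "bc_e1 * bc_e2 = 0" "bc_e1 + bc_e2 = 1"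
  by (simp_all add: bc_i1_def bc_i2_def bc_j_def bc_e1_def bc_e2_def bc_of_complex_def
      one_bicomplex_def zero_bicomplex_def plus_bicomplex_def minus_bicomplex_def
      uminus_bicomplex_def times_bicomplex_def)

lemma bc_idempotent_form: "w = bc_of_complex (bc_P1 w) * bc_e1 + bc_of_complex (bc_P2 w) * bc_e2"
  by (cases w)
    (simp add: bc_P1_def bc_P2_def bc_i1_def bc_i2_def bc_j_def bc_e1_def bc_e2_def
      bc_of_complex_def one_bicomplex_def plus_bicomplex_def minus_bicomplex_def
      times_bicomplex_def field_simps)

lemma bc_P_add:
  "bc_P1 (v + w) = bc_P1 v + bc_P1 w" "bc_P2 (v + w) = bc_P2 v + bc_P2 w"
  by (simp_all add: bc_P1_def bc_P2_def plus_bicomplex_def algebra_simps)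

lemma bc_P_mult:
  "bc_P1 (v * w) = bc_P1 v * bc_P1 w" "bc_P2 (v * w) = bc_P2 v * bc_P2 w"
  by (simp_all add: bc_P1_def bc_P2_def times_bicomplex_def algebra_simps)

lemma bc_norm_power2_P: "(bc_norm w)\<^sup>2 = ((cmod (bc_P1 w))\<^sup>2 + (cmod (bc_P2 w))\<^sup>2) / 2"
  unfolding bc_norm_def bc_P1_def bc_P2_def cmod_power2
  by (simp add: power2_eq_square algebra_simps)


section \<open>Bicomplex Hilbert spaces\<close>

definition bc_induced_norm :: "('v \<Rightarrow> 'v \<Rightarrow> bicomplex) \<Rightarrow> 'v \<Rightarrow> real" where
  "bc_induced_norm sp x = (1 / sqrt 2) * sqrt (Re (bc_P1 (sp x x) + bc_P2 (sp x x)))"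
  \<comment> \<open>for a scalar product the radicand is real, by hyperbolic positivity, so \<^const>\<open>Re\<close> is
      only a change of type\<close>

locale bicomplex_scalar_product = module scale
  for scale :: "bicomplex \<Rightarrow> 'v::ab_group_add \<Rightarrow> 'v" +
  fixes sp :: "'v \<Rightarrow> 'v \<Rightarrow> bicomplex"
  assumes sp_add: "sp x (y + z) = sp x y + sp x z"
    and sp_scale: "sp x (scale a y) = a * sp x y"
    and sp_commute: "sp x y = bc_dagger3 (sp y x)"
    and sp_eq_zero_iff: "sp x x = 0 \<longleftrightarrow> x = 0"
    and sp_positive: "sp x x \<in> bc_Dplus"

locale bicomplex_hilbert_space = bicomplex_scalar_product scale sp
  for scale :: "bicomplex \<Rightarrow> 'v::ab_group_add \<Rightarrow> 'v" and sp :: "'v \<Rightarrow> 'v \<Rightarrow> bicomplex" +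
  assumes complete: "Metric_space.mcomplete UNIV (\<lambda>x y. bc_induced_norm sp (x - y))"
    and infinite_dimensional: "\<exists>S. finite S \<and> card S = n \<and> independent S"


section \<open>The space of square-summable bicomplex sequences\<close>

text \<open>Sequences are indexed by \<^typ>\<open>nat\<close>, so the term of index \<open>l\<close> here is \<open>w\<^sub>l\<^sub>+\<^sub>1\<close>.\<close>

typedef l22 = "{w :: nat \<Rightarrow> bicomplex. summable (\<lambda>l. (bc_norm (w l))\<^sup>2)}"
  morphisms l22_nth Abs_l22
  by (rule exI[of _ "\<lambda>_. 0"]) (simp add: bc_norm_def zero_bicomplex_def)

setup_lifting type_definition_l22

lemma bc_norm_minus: "bc_norm (- w) = bc_norm w"
  by (simp add: bc_norm_def uminus_bicomplex_def)

lemma bc_norm_add_power2_le: "(bc_norm (v + w))\<^sup>2 \<le> 2 * (bc_norm v)\<^sup>2 + 2 * (bc_norm w)\<^sup>2"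
proof -
  have "(cmod (a + b))\<^sup>2 \<le> 2 * (cmod a)\<^sup>2 + 2 * (cmod b)\<^sup>2" for a b
  proof -
    have "(cmod (a + b))\<^sup>2 + (cmod (a - b))\<^sup>2 = 2 * (cmod a)\<^sup>2 + 2 * (cmod b)\<^sup>2"
      unfolding cmod_power2 by (simp add: power2_eq_square algebra_simps)
    then show ?thesis by (smt (verit) zero_le_power2)
  qed
  from this[of "bc_fst v" "bc_fst w"] this[of "bc_snd v" "bc_snd w"] show ?thesis
    by (simp add: bc_norm_def plus_bicomplex_def)
qed

lemma bc_norm_mult_power2_le:
  "(bc_norm (v * w))\<^sup>2 \<le> ((cmod (bc_P1 v))\<^sup>2 + (cmod (bc_P2 v))\<^sup>2) * (bc_norm w)\<^sup>2"
  by (simp add: bc_norm_power2_P bc_P_mult norm_mult power_mult_distrib algebra_simps)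

lemma summable_bc_norm_add:
  assumes "summable (\<lambda>l. (bc_norm (v l))\<^sup>2)" "summable (\<lambda>l. (bc_norm (w l))\<^sup>2)"
  shows "summable (\<lambda>l. (bc_norm (v l + w l))\<^sup>2)"
proof (rule summable_comparison_test')
  show "summable (\<lambda>l. 2 * (bc_norm (v l))\<^sup>2 + 2 * (bc_norm (w l))\<^sup>2)"
    by (intro summable_add summable_mult assms)
qed (use bc_norm_add_power2_le in auto)

lemma summable_bc_norm_mult:
  assumes "summable (\<lambda>l. (bc_norm (w l))\<^sup>2)"
  shows "summable (\<lambda>l. (bc_norm (c * w l))\<^sup>2)"
proof (rule summable_comparison_test')
  show "summable (\<lambda>l. ((cmod (bc_P1 c))\<^sup>2 + (cmod (bc_P2 c))\<^sup>2) * (bc_norm (w l))\<^sup>2)"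
    by (intro summable_mult assms)
qed (use bc_norm_mult_power2_le in auto)

instantiation l22 :: ab_group_add
begin

lift_definition zero_l22 :: l22 is "\<lambda>_. 0"
  by (simp add: bc_norm_def zero_bicomplex_def)
lift_definition plus_l22 :: "l22 \<Rightarrow> l22 \<Rightarrow> l22" is "\<lambda>v w l. v l + w l"
  by (rule summable_bc_norm_add)
lift_definition uminus_l22 :: "l22 \<Rightarrow> l22" is "\<lambda>w l. - w l"
  by (simp add: bc_norm_minus)
lift_definition minus_l22 :: "l22 \<Rightarrow> l22 \<Rightarrow> l22" is "\<lambda>v w l. v l - w l"
  using summable_bc_norm_add[where w = "\<lambda>l. - w l" for w] by (simp add: bc_norm_minus)

instance
  by standard (transfer; simp add: algebra_simps)+

end

lift_definition l22_scale :: "bicomplex \<Rightarrow> l22 \<Rightarrow> l22" is "\<lambda>c w l. c * w l"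
  by (rule summable_bc_norm_mult)

definition l22_sp :: "l22 \<Rightarrow> l22 \<Rightarrow> bicomplex" where
  "l22_sp v w =
     bc_e1 * bc_of_complex (\<Sum>l. cnj (bc_P1 (l22_nth v l)) * bc_P1 (l22_nth w l)) +
     bc_e2 * bc_of_complex (\<Sum>l. cnj (bc_P2 (l22_nth v l)) * bc_P2 (l22_nth w l))"

definition l22_norm :: "l22 \<Rightarrow> real" where
  "l22_norm w = sqrt (\<Sum>l. (bc_norm (l22_nth w l))\<^sup>2)"

end

(* The components P1 and P2 turn the bicomplex norm into an average of two squared complex moduli,
   so the scalar product axioms reduce to facts about two complex l2 scalar products. Completeness
   is the classical argument: a Cauchy sequence converges coordinatewise, and the Cauchy estimate on
   partial sums passes to the limit. The unit sequences give infinite dimension. *)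

theory Submission
  imports Defs
begin

section \<open>Idempotent components\<close>

text \<open>Since \<open>bc_P1\<close> and \<open>bc_P2\<close> are multiplicative and additive,
  this reduces identities of bicomplex numbers to pairs of identities in the complex field.\<close>

lemma bicomplex_eq_iff_P: "v = w \<longleftrightarrow> bc_P1 v = bc_P1 w \<and> bc_P2 v = bc_P2 w"
  using bc_idempotent_form[of v] bc_idempotent_form[of w] by auto

lemma bc_P_simps [simp]:
  "bc_P1 0 = 0" "bc_P2 0 = 0"
  "bc_P1 (bc_of_complex z) = z" "bc_P2 (bc_of_complex z) = z"
  "bc_P1 bc_e1 = 1" "bc_P2 bc_e1 = 0" "bc_P1 bc_e2 = 0" "bc_P2 bc_e2 = 1"
  "bc_P1 (bc_dagger3 w) = cnj (bc_P1 w)" "bc_P2 (bc_dagger3 w) = cnj (bc_P2 w)"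
  by (simp_all add: bc_P1_def bc_P2_def bc_i1_def bc_i2_def bc_j_def bc_e1_def bc_e2_def
      bc_dagger3_def bc_of_complex_def zero_bicomplex_def one_bicomplex_def plus_bicomplex_def
      minus_bicomplex_def times_bicomplex_def)

lemma bc_Dplus_iff:
  "w \<in> bc_Dplus \<longleftrightarrow> (\<exists>x y. 0 \<le> x \<and> 0 \<le> y \<and> bc_P1 w = of_real x \<and> bc_P2 w = of_real y)"
  unfolding bc_Dplus_def by (auto simp: bicomplex_eq_iff_P bc_P_add bc_P_mult)

text \<open>Bicomplex numbers carry no topology of their own here; the product space of two complex
  lines lends them its triangle inequality and its completeness.\<close>

lemma bc_norm_eq_norm_Pair: "bc_norm w = norm (bc_fst w, bc_snd w)"
  by (simp add: bc_norm_def norm_Pair)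

lemma bc_norm_nonneg [simp]: "0 \<le> bc_norm w"
  by (simp add: bc_norm_def)

lemma bc_norm_eq_0_iff [simp]: "bc_norm w = 0 \<longleftrightarrow> w = 0"
  by (cases w) (simp add: bc_norm_eq_norm_Pair zero_bicomplex_def zero_prod_def)

lemma bc_norm_triangle: "bc_norm (v + w) \<le> bc_norm v + bc_norm w"
  using norm_triangle_ineq[of "(bc_fst v, bc_snd v)" "(bc_fst w, bc_snd w)"]
  by (simp add: bc_norm_eq_norm_Pair plus_bicomplex_def)


section \<open>The norm of square-summable sequences\<close>

lemma summable_l22_nth: "summable (\<lambda>l. (bc_norm (l22_nth w l))\<^sup>2)"
  using l22_nth by simp

lemma l22_nth_simps [simp]:
  "l22_nth 0 l = 0"
  "l22_nth (v + w) l = l22_nth v l + l22_nth w l"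
  "l22_nth (- w) l = - l22_nth w l"
  "l22_nth (v - w) l = l22_nth v l - l22_nth w l"
  "l22_nth (l22_scale c w) l = c * l22_nth w l"
  by (transfer; simp)+

lemma l22_eqI: "(\<And>l. l22_nth v l = l22_nth w l) \<Longrightarrow> v = w"
  by (metis ext l22_nth_inject)

text \<open>Finite sections approximate the norm, so that Minkowski's inequality for finite sums
  carries over to sequences.\<close>

lemma L2_set_tendsto_l22_norm:
  "(\<lambda>n. L2_set (\<lambda>l. bc_norm (l22_nth w l)) {..<n}) \<longlonglongrightarrow> l22_norm w"
  unfolding L2_set_def l22_norm_def
  by (intro tendsto_real_sqrt summable_LIMSEQ summable_l22_nth)

lemma L2_set_le_l22_norm: "L2_set (\<lambda>l. bc_norm (l22_nth w l)) {..<n} \<le> l22_norm w"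
  unfolding L2_set_def l22_norm_def
  by (intro real_sqrt_le_mono sum_le_suminf summable_l22_nth) auto

lemma l22_norm_nonneg: "0 \<le> l22_norm w"
  unfolding l22_norm_def by (intro real_sqrt_ge_zero suminf_nonneg summable_l22_nth) simp

lemma bc_norm_le_l22_norm: "bc_norm (l22_nth w l) \<le> l22_norm w"
  using member_le_L2_set[of "{..<Suc l}" l "\<lambda>l. bc_norm (l22_nth w l)"]
    L2_set_le_l22_norm[of w "Suc l"] by simp

lemma l22_norm_eq_0_iff: "l22_norm w = 0 \<longleftrightarrow> w = 0"
proof
  assume "l22_norm w = 0"
  then have "l22_nth w l = 0" for l
    using bc_norm_le_l22_norm[of w l] by (metis antisym bc_norm_eq_0_iff bc_norm_nonneg)
  then show "w = 0" by (intro l22_eqI) simp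
qed (simp add: l22_norm_def bc_norm_def zero_bicomplex_def)

lemma l22_norm_minus_commute: "l22_norm (v - w) = l22_norm (w - v)"
  unfolding l22_norm_def l22_nth_simps by (metis bc_norm_minus minus_diff_eq)

lemma l22_norm_triangle: "l22_norm (v + w) \<le> l22_norm v + l22_norm w"
proof (rule LIMSEQ_le_const2[OF L2_set_tendsto_l22_norm], intro exI allI impI)
  fix n
  let ?N = "\<lambda>u l. bc_norm (l22_nth u l)"
  have "L2_set (?N (v + w)) {..<n} \<le> L2_set (\<lambda>l. ?N v l + ?N w l) {..<n}"
    by (intro L2_set_mono) (auto simp: bc_norm_triangle)
  also have "\<dots> \<le> L2_set (?N v) {..<n} + L2_set (?N w) {..<n}"
    by (rule L2_set_triangle_ineq)
  also have "\<dots> \<le> l22_norm v + l22_norm w"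
    by (intro add_mono L2_set_le_l22_norm)
  finally show "L2_set (?N (v + w)) {..<n} \<le> l22_norm v + l22_norm w" .
qed

section \<open>Completeness with respect to \<open>l22_norm\<close>\<close>

interpretation l22: Metric_space UNIV "\<lambda>v w. l22_norm (v - w)"
proof
  fix u v w :: l22
  show "l22_norm (u - w) \<le> l22_norm (u - v) + l22_norm (v - w)"
    using l22_norm_triangle[of "u - v" "v - w"] by simp
qed (auto simp: l22_norm_nonneg l22_norm_eq_0_iff l22_norm_minus_commute)

text \<open>Each coordinate is dominated by the norm, hence is Cauchy in a complete space. The limit
  \<open>y\<close> is a bare function, because its square-summability is still open.\<close>

lemma l22_coordinates_converge:
  assumes "l22.MCauchy \<sigma>"
  obtains y where
    "\<And>l. (\<lambda>n. bc_fst (l22_nth (\<sigma> n) l)) \<longlonglongrightarrow> bc_fst (y l)"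
    "\<And>l. (\<lambda>n. bc_snd (l22_nth (\<sigma> n) l)) \<longlonglongrightarrow> bc_snd (y l)"
proof -
  let ?p = "\<lambda>l n. (bc_fst (l22_nth (\<sigma> n) l), bc_snd (l22_nth (\<sigma> n) l))"
  have "Cauchy (?p l)" for l
  proof (rule CauchyI)
    fix e :: real
    assume "0 < e"
    then obtain N where N: "\<And>m n. N \<le> m \<Longrightarrow> N \<le> n \<Longrightarrow> l22_norm (\<sigma> m - \<sigma> n) < e"
      using assms unfolding l22.MCauchy_def by blast
    have "norm (?p l m - ?p l n) \<le> l22_norm (\<sigma> m - \<sigma> n)" for m n
      using bc_norm_le_l22_norm[of "\<sigma> m - \<sigma> n" l]
      by (simp add: bc_norm_eq_norm_Pair minus_bicomplex_def)
    then show "\<exists>N. \<forall>m\<ge>N. \<forall>n\<ge>N. norm (?p l m - ?p l n) < e"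
      using N by (meson le_less_trans)
  qed
  then have "\<exists>q. ?p l \<longlonglongrightarrow> q" for l
    using Cauchy_convergent convergent_def by blast
  then obtain q where q: "\<And>l. ?p l \<longlonglongrightarrow> q l"
    by metis
  show thesis
    by (rule that[of "\<lambda>l. Bicomplex (fst (q l)) (snd (q l))"])
      (use tendsto_fst[OF q] tendsto_snd[OF q] in simp_all)
qed

lemma l22_mcomplete: "l22.mcomplete"
  unfolding l22.mcomplete_def
proof (intro allI impI)
  fix \<sigma> :: "nat \<Rightarrow> l22"
  assume Cauchy: "l22.MCauchy \<sigma>"
  obtain y where
    y: "\<And>l. (\<lambda>n. bc_fst (l22_nth (\<sigma> n) l)) \<longlonglongrightarrow> bc_fst (y l)"
      "\<And>l. (\<lambda>n. bc_snd (l22_nth (\<sigma> n) l)) \<longlonglongrightarrow> bc_snd (y l)"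
    using l22_coordinates_converge[OF Cauchy] by blast
  have conv: "(\<lambda>m. bc_norm (l22_nth (\<sigma> m) l - l22_nth w l)) \<longlonglongrightarrow> bc_norm (y l - l22_nth w l)"
    for l w
    unfolding bc_norm_def minus_bicomplex_def bicomplex.sel by (intro tendsto_intros y)
  \<comment> \<open>\<open>N\<close> does not depend on \<open>K\<close>: this uniformity later
    allows \<open>K\<close> to go to infinity.\<close>
  have partial: "\<exists>N. \<forall>n\<ge>N. \<forall>K. (\<Sum>l<K. (bc_norm (y l - l22_nth (\<sigma> n) l))\<^sup>2) \<le> e\<^sup>2"
    if "0 < e" for e
  proof -
    obtain N where N: "\<And>m n. N \<le> m \<Longrightarrow> N \<le> n \<Longrightarrow> l22_norm (\<sigma> m - \<sigma> n) < e"
      using Cauchy \<open>0 < e\<close> unfolding l22.MCauchy_def by blast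
    have "(\<Sum>l<K. (bc_norm (y l - l22_nth (\<sigma> n) l))\<^sup>2) \<le> e\<^sup>2" if "N \<le> n" for n K
    \<comment> \<open>With \<open>n\<close> and \<open>K\<close> fixed, let \<open>m\<close> tend to
      infinity; the sum is finite, so the limit is taken termwise.\<close>
    proof (rule LIMSEQ_le_const2)
      show "(\<lambda>m. \<Sum>l<K. (bc_norm (l22_nth (\<sigma> m) l - l22_nth (\<sigma> n) l))\<^sup>2)
          \<longlonglongrightarrow> (\<Sum>l<K. (bc_norm (y l - l22_nth (\<sigma> n) l))\<^sup>2)"
        by (intro tendsto_intros conv)
      have "(\<Sum>l<K. (bc_norm (l22_nth (\<sigma> m) l - l22_nth (\<sigma> n) l))\<^sup>2) \<le> e\<^sup>2" if "N \<le> m" for m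
      proof -
        have "L2_set (\<lambda>l. bc_norm (l22_nth (\<sigma> m - \<sigma> n) l)) {..<K} \<le> e"
          using L2_set_le_l22_norm[of "\<sigma> m - \<sigma> n" K] N[OF that \<open>N \<le> n\<close>] by linarith
        then show ?thesis
          unfolding L2_set_def using sqrt_le_D by simp
      qed
      then show "\<exists>M. \<forall>m\<ge>M. (\<Sum>l<K. (bc_norm (l22_nth (\<sigma> m) l - l22_nth (\<sigma> n) l))\<^sup>2) \<le> e\<^sup>2"
        by blast
    qed
    then show ?thesis by blast
  qed
  have diff: "summable (\<lambda>l. (bc_norm (y l - l22_nth (\<sigma> n) l))\<^sup>2)"
    if "\<And>K. (\<Sum>l<K. (bc_norm (y l - l22_nth (\<sigma> n) l))\<^sup>2) \<le> B" for n B
    using that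
    by (intro bounded_imp_summable[where B = B])
      (simp_all only: zero_le_power2 lessThan_Suc_atMost[symmetric])
  \<comment> \<open>Any positive bound would do: \<open>y\<close> is the sum of
    \<open>y - \<sigma> N\<close> and \<open>\<sigma> N\<close>, both square-summable.\<close>
  obtain N where "\<And>K. (\<Sum>l<K. (bc_norm (y l - l22_nth (\<sigma> N) l))\<^sup>2) \<le> 1"
    using partial[of 1] by auto
  from summable_bc_norm_add[OF diff[OF this] summable_l22_nth[of "\<sigma> N"]]
  have "summable (\<lambda>l. (bc_norm (y l))\<^sup>2)" by simp
  then have nth: "l22_nth (Abs_l22 y) = y"
    by (intro Abs_l22_inverse) simp
  have "\<exists>N. \<forall>n\<ge>N. l22_norm (\<sigma> n - Abs_l22 y) < e" if "0 < e" for e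
  proof -
    \<comment> \<open>Limits preserve only weak inequalities; halving \<open>e\<close> restores the
      strict one.\<close>
    obtain N where N: "\<And>n K. N \<le> n \<Longrightarrow> (\<Sum>l<K. (bc_norm (y l - l22_nth (\<sigma> n) l))\<^sup>2) \<le> (e/2)\<^sup>2"
      using partial[of "e/2"] \<open>0 < e\<close> by auto
    have "l22_norm (\<sigma> n - Abs_l22 y) < e" if "N \<le> n" for n
    proof -
      have "l22_norm (Abs_l22 y - \<sigma> n) \<le> e/2"
        unfolding l22_norm_def l22_nth_simps nth
        using \<open>0 < e\<close> by (intro real_le_lsqrt suminf_le_const diff[OF N] N that) simp_all
      then show ?thesis
        using \<open>0 < e\<close> by (simp add: l22_norm_minus_commute[of "\<sigma> n"])
    qed
    then show ?thesis by blast
  qed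
  then show "\<exists>x. limitin l22.mtopology \<sigma> x sequentially"
    by (auto simp: l22.limit_metric_sequentially)
qed


section \<open>The scalar product\<close>

lemma cmod_P_power2_le:
  "(cmod (bc_P1 w))\<^sup>2 \<le> 2 * (bc_norm w)\<^sup>2" "(cmod (bc_P2 w))\<^sup>2 \<le> 2 * (bc_norm w)\<^sup>2"
  by (simp_all add: bc_norm_power2_P)

lemma summable_cmod_P_power2:
  "summable (\<lambda>l. (cmod (bc_P1 (l22_nth w l)))\<^sup>2)" "summable (\<lambda>l. (cmod (bc_P2 (l22_nth w l)))\<^sup>2)"
  by (rule summable_comparison_test'[OF summable_mult[OF summable_l22_nth[of w], of 2]],
      use cmod_P_power2_le in simp)+

text \<open>Comparison through \<open>2 * x * y \<le> x^2 + y^2\<close> for the moduli gives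
  absolute convergence.\<close>

lemma summable_cnj_mult:
  fixes f g :: "nat \<Rightarrow> complex"
  assumes "summable (\<lambda>l. (cmod (f l))\<^sup>2)" "summable (\<lambda>l. (cmod (g l))\<^sup>2)"
  shows "summable (\<lambda>l. cnj (f l) * g l)"
proof (rule summable_comparison_test')
  show "summable (\<lambda>l. (cmod (f l))\<^sup>2 + (cmod (g l))\<^sup>2)"
    by (intro summable_add assms)
  show "norm (cnj (f l) * g l) \<le> (cmod (f l))\<^sup>2 + (cmod (g l))\<^sup>2" if "0 \<le> l" for l
    using sum_squares_bound[of "cmod (f l)" "cmod (g l)"]
      mult_nonneg_nonneg[OF norm_ge_zero norm_ge_zero, of "f l" "g l"]
    unfolding norm_mult complex_mod_cnj by linarith
qed

text \<open>These make the infinite sums in \<open>l22_sp\<close> genuine limits and justify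
  termwise operations on them.\<close>

lemmas summable_l22_sp =
  summable_cnj_mult[OF summable_cmod_P_power2(1) summable_cmod_P_power2(1)]
  summable_cnj_mult[OF summable_cmod_P_power2(2) summable_cmod_P_power2(2)]

lemma bc_P_l22_sp:
  "bc_P1 (l22_sp v w) = (\<Sum>l. cnj (bc_P1 (l22_nth v l)) * bc_P1 (l22_nth w l))"
  "bc_P2 (l22_sp v w) = (\<Sum>l. cnj (bc_P2 (l22_nth v l)) * bc_P2 (l22_nth w l))"
  by (simp_all add: l22_sp_def bc_P_add bc_P_mult)

lemma bc_P_l22_sp_self:
  "bc_P1 (l22_sp w w) = of_real (\<Sum>l. (cmod (bc_P1 (l22_nth w l)))\<^sup>2)"
  "bc_P2 (l22_sp w w) = of_real (\<Sum>l. (cmod (bc_P2 (l22_nth w l)))\<^sup>2)"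
proof -
  have "cnj z * z = of_real ((cmod z)\<^sup>2)" for z
    by (simp only: complex_norm_square mult.commute)
  then show "bc_P1 (l22_sp w w) = of_real (\<Sum>l. (cmod (bc_P1 (l22_nth w l)))\<^sup>2)"
    "bc_P2 (l22_sp w w) = of_real (\<Sum>l. (cmod (bc_P2 (l22_nth w l)))\<^sup>2)"
    unfolding bc_P_l22_sp by (simp_all only: suminf_of_real[OF summable_cmod_P_power2(1)]
        suminf_of_real[OF summable_cmod_P_power2(2)])
qed

text \<open>The factor \<open>1 / sqrt 2\<close> of the induced norm matches the averaging over the
  two components in \<open>bc_norm_power2_P\<close>.\<close>

lemma l22_induced_norm: "bc_induced_norm l22_sp w = l22_norm w"
proof -
  have "(\<Sum>l. (bc_norm (l22_nth w l))\<^sup>2) =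
      ((\<Sum>l. (cmod (bc_P1 (l22_nth w l)))\<^sup>2) + (\<Sum>l. (cmod (bc_P2 (l22_nth w l)))\<^sup>2)) / 2"
    unfolding bc_norm_power2_P
    by (simp add: suminf_add summable_cmod_P_power2 suminf_divide summable_add)
  then show ?thesis
    by (simp only: l22_norm_def)
      (simp add: bc_induced_norm_def bc_P_l22_sp_self real_sqrt_divide)
qed

lemma l22_sp_self_eq_0_iff: "l22_sp w w = 0 \<longleftrightarrow> w = 0"
proof
  assume "l22_sp w w = 0"
  \<comment> \<open>Definiteness is inherited from the norm, since the induced norm depends only on
    \<open>l22_sp w w\<close>.\<close>
  then have "l22_norm w = 0"
    unfolding l22_induced_norm[symmetric] bc_induced_norm_def by simp
  then show "w = 0" by (simp add: l22_norm_eq_0_iff)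
qed (simp add: bicomplex_eq_iff_P bc_P_l22_sp)

interpretation l22: bicomplex_scalar_product l22_scale l22_sp
proof
  fix x y z :: l22 and a b :: bicomplex
  show "l22_scale a (x + y) = l22_scale a x + l22_scale a y"
    "l22_scale (a + b) x = l22_scale a x + l22_scale b x"
    "l22_scale a (l22_scale b x) = l22_scale (a * b) x"
    "l22_scale 1 x = x"
    by (rule l22_eqI; simp add: algebra_simps)+
  show "l22_sp x (y + z) = l22_sp x y + l22_sp x z"
    by (simp add: bicomplex_eq_iff_P bc_P_l22_sp bc_P_add distrib_left suminf_add summable_l22_sp)
  show "l22_sp x (l22_scale a y) = a * l22_sp x y"
    by (simp add: bicomplex_eq_iff_P bc_P_l22_sp bc_P_mult mult.left_commute suminf_mult
        summable_l22_sp)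
  show "l22_sp x y = bc_dagger3 (l22_sp y x)"
    \<comment> \<open>\<open>bc_dagger3\<close> conjugates each idempotent component without
      swapping them, and conjugation, being bounded and linear, passes through the series.\<close>
    unfolding bicomplex_eq_iff_P bc_P_simps bc_P_l22_sp
      bounded_linear.suminf[OF bounded_linear_cnj summable_l22_sp(1)]
      bounded_linear.suminf[OF bounded_linear_cnj summable_l22_sp(2)]
    by (simp add: mult.commute)
  show "l22_sp x x = 0 \<longleftrightarrow> x = 0"
    by (rule l22_sp_self_eq_0_iff)
  show "l22_sp x x \<in> bc_Dplus"
    unfolding bc_Dplus_iff bc_P_l22_sp_self
    \<comment> \<open>Reflexivity instantiates both witnesses with the real sums, leaving their
      nonnegativity.\<close>
    by (intro exI conjI; (rule refl)?; intro suminf_nonneg summable_cmod_P_power2 zero_le_power2)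
qed


section \<open>Infinite dimension\<close>

lift_definition l22_unit :: "nat \<Rightarrow> l22" is "\<lambda>i l. if l = i then 1 else 0"
  by (rule summable_finite[of "{i}" for i]) auto

lemma l22_nth_unit [simp]: "l22_nth (l22_unit i) l = (if l = i then 1 else 0)"
  by transfer simp

lemma inj_l22_unit: "inj l22_unit"
proof (rule injI)
  fix i j
  assume "l22_unit i = l22_unit j"
  then have "l22_nth (l22_unit i) i = l22_nth (l22_unit j) i" by simp
  then show "i = j" by (simp split: if_splits)
qed

lemma l22_nth_sum: "l22_nth (sum f A) l = (\<Sum>a\<in>A. l22_nth (f a) l)"
  by (induction A rule: infinite_finite_induct) simp_all

text \<open>Coordinate \<open>i\<close> of a combination of unit sequences is the coefficient of the
  \<open>i\<close>-th one itself. Nothing is divided, so the zero divisors among the scalars do no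
  harm.\<close>

lemma independent_range_l22_unit: "l22.independent (range l22_unit)"
  unfolding l22.dependent_explicit
proof clarify
  fix T u v
  assume T: "finite T" "T \<subseteq> range l22_unit" "(\<Sum>x\<in>T. l22_scale (u x) x) = 0"
    and "v \<in> T" "u v \<noteq> 0"
  then obtain i where i: "v = l22_unit i" by blast
  have "l22_nth (l22_scale (u x) x) i = (if x = v then u x else 0)" if "x \<in> T" for x
    using that T(2) by (auto simp: i inj_eq[OF inj_l22_unit])
  then have "l22_nth (\<Sum>x\<in>T. l22_scale (u x) x) i = u v"
    \<comment> \<open>The coordinate rule for \<open>l22_scale\<close> is withheld so that each
      summand keeps the form rewritten by the preceding fact.\<close>
    using \<open>finite T\<close> \<open>v \<in> T\<close> by (simp add: l22_nth_sum del: l22_nth_simps(5))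
  then show False
    using T(3) \<open>u v \<noteq> 0\<close> by simp
qed

theorem theorem3p9:
  shows "(\<forall>v w. summable (\<lambda>l. cnj (bc_P1 (l22_nth v l)) * bc_P1 (l22_nth w l)) \<and>
                summable (\<lambda>l. cnj (bc_P2 (l22_nth v l)) * bc_P2 (l22_nth w l))) \<and>
         (\<forall>w. bc_induced_norm l22_sp w = l22_norm w) \<and>
         bicomplex_hilbert_space l22_scale l22_sp"
proof (intro conjI allI summable_l22_sp l22_induced_norm)
  show "bicomplex_hilbert_space l22_scale l22_sp"
  proof
    show "Metric_space.mcomplete UNIV (\<lambda>x y. bc_induced_norm l22_sp (x - y))"
      using l22_mcomplete by (simp only: l22_induced_norm)
    fix n
    \<comment> \<open>The first \<open>n\<close> unit sequences are the required witnesses;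
      injectivity ensures that there are exactly \<open>n\<close> of them.\<close>
    have "inj_on l22_unit {..<n}"
      using inj_l22_unit inj_on_subset by blast
    then have "card (l22_unit ` {..<n}) = n"
      by (simp add: card_image)
    moreover have "l22.independent (l22_unit ` {..<n})"
      by (rule l22.independent_mono[OF independent_range_l22_unit]) blast
    ultimately show "\<exists>S. finite S \<and> card S = n \<and> l22.independent S"
      by blast
  qed
qed

end
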